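(* Let $G$ be a finitely generated profinite group which satisfies a coset identity of length $m$. Assume that $d(G)>6m$. Then $G$ has an open normal subgroup $H$ with $$\frac{d(H)-1}{|G:H|}<\alpha\,(d(G)-1),\qquad\text{where } \alpha=\frac{2m-1}{2m}.$$
   Context: For a profinite group $H$, $d(H)$ denotes the minimal number of topological generators of $H$. A coset identity on a profinite group $G$ consists of a nontrivial (reduced) group word $w(x_1,\dots,x_k)$ in $k$ letters (a nontrivial element of the free group on $x_1,\dots,x_k$), an open normal subgroup $K$ of $G$ and $k$ cosets $g_1K,\dots,g_kK$ in $G/K$ such that $w(g_1h_1,\dots,g_kh_k)=1$ for all $h_1,\dots,h_k\in K$. The length of the coset identity is the length of the reduced word $w$. *)

theory Defs
  imports
    "HOL-Algebra.Coset"
    "HOL-Algebra.Generated_Groups"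
    "HOL-Analysis.Abstract_Topological_Spaces"
    "HOL-Library.Extended_Real"
begin

definition topological_group :: "('a, 'b) monoid_scheme \<Rightarrow> 'a topology \<Rightarrow> bool" where
  "topological_group G T \<longleftrightarrow>
     group G \<and> topspace T = carrier G \<and>
     continuous_map (prod_topology T T) T (\<lambda>(x, y). x \<otimes>\<^bsub>G\<^esub> y) \<and>
     continuous_map T T (\<lambda>x. inv\<^bsub>G\<^esub> x)"

definition totally_disconnected_space :: "'a topology \<Rightarrow> bool" where
  "totally_disconnected_space T \<longleftrightarrow> (\<forall>C. connectedin T C \<longrightarrow> (\<exists>x. C \<subseteq> {x}))"

definition profinite_group :: "('a, 'b) monoid_scheme \<Rightarrow> 'a topology \<Rightarrow> bool" where
  "profinite_group G T \<longleftrightarrow>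
     topological_group G T \<and> compact_space T \<and> Hausdorff_space T \<and> totally_disconnected_space T"

definition topologically_generates ::
    "('a, 'b) monoid_scheme \<Rightarrow> 'a topology \<Rightarrow> 'a set \<Rightarrow> bool" where
  "topologically_generates G T S \<longleftrightarrow>
     S \<subseteq> carrier G \<and> T closure_of (generate G S) = carrier G"

definition topologically_finitely_generated :: "('a, 'b) monoid_scheme \<Rightarrow> 'a topology \<Rightarrow> bool" where
  "topologically_finitely_generated G T \<longleftrightarrow> (\<exists>S. finite S \<and> topologically_generates G T S)"

text \<open>The minimal number of topological generators; it is \<open>\<infinity>\<close> (the infimum of the
  empty set) precisely when there is no finite topological generating set.\<close>

definition min_generators :: "('a, 'b) monoid_scheme \<Rightarrow> 'a topology \<Rightarrow> enat" where
  "min_generators G T = (INF S \<in> {S. finite S \<and> topologically_generates G T S}. enat (card S))"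

abbreviation min_generators_subgroup ::
    "('a, 'b) monoid_scheme \<Rightarrow> 'a topology \<Rightarrow> 'a set \<Rightarrow> enat" where
  "min_generators_subgroup G T H \<equiv> min_generators (G\<lparr>carrier := H\<rparr>) (subtopology T H)"

definition open_normal :: "'a set \<Rightarrow> ('a, 'b) monoid_scheme \<Rightarrow> 'a topology \<Rightarrow> bool" where
  "open_normal K G T \<longleftrightarrow> K \<lhd> G \<and> openin T K"

text \<open>The letter \<open>(i, True)\<close> stands for the variable \<open>x\<^sub>i\<close> and \<open>(i, False)\<close> for its
  inverse; variables are numbered from \<open>0\<close>. An element of the free group on \<open>k\<close> letters
  is represented by its reduced word, which is nontrivial iff it is nonempty.\<close>

type_synonym group_word = "(nat \<times> bool) list"

definition reduced_word :: "nat \<Rightarrow> group_word \<Rightarrow> bool" where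
  "reduced_word k w \<longleftrightarrow>
     (\<forall>(i, b) \<in> set w. i < k) \<and>
     successively (\<lambda>(i, b) (j, c). \<not> (i = j \<and> b \<noteq> c)) w"

definition word_value :: "('a, 'b) monoid_scheme \<Rightarrow> group_word \<Rightarrow> (nat \<Rightarrow> 'a) \<Rightarrow> 'a" where
  "word_value G w x =
     foldr (\<lambda>(i, b) y. (if b then x i else inv\<^bsub>G\<^esub> (x i)) \<otimes>\<^bsub>G\<^esub> y) w \<one>\<^bsub>G\<^esub>"

definition coset_identity ::
    "('a, 'b) monoid_scheme \<Rightarrow> 'a topology \<Rightarrow> nat \<Rightarrow> group_word \<Rightarrow> 'a set \<Rightarrow> (nat \<Rightarrow> 'a) \<Rightarrow> bool" where
  "coset_identity G T k w K g \<longleftrightarrow>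
     reduced_word k w \<and> w \<noteq> [] \<and> open_normal K G T \<and>
     (\<forall>i<k. g i \<in> carrier G) \<and>
     (\<forall>h. (\<forall>i<k. h i \<in> K) \<longrightarrow> word_value G w (\<lambda>i. g i \<otimes>\<^bsub>G\<^esub> h i) = \<one>\<^bsub>G\<^esub>)"

definition satisfies_coset_identity_of_length ::
    "('a, 'b) monoid_scheme \<Rightarrow> 'a topology \<Rightarrow> nat \<Rightarrow> bool" where
  "satisfies_coset_identity_of_length G T m \<longleftrightarrow>
     (\<exists>k w K g. coset_identity G T k w K g \<and> length w = m)"

end

theory Submission
  imports Defs
begin

text \<open>Let \<open>S\<close> be a generating set of \<open>d = d(G)\<close> elements and \<open>K\<close> an open normal subgroup of index \<open>n\<close>.
A transversal of \<open>K\<close> yields one Schreier generator of \<open>K\<close> for each of the \<open>n * d\<close> edges \<open>(v, s)\<close> of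
the Schreier graph of \<open>G/K\<close>. The identity is used to discard about \<open>n * d / m\<close> of them.

Changing one variable of the word \<open>w\<close> from \<open>g i\<close> to \<open>g i \<otimes> h\<close>, with \<open>h \<in> K\<close>, multiplies the value of
\<open>w\<close> by a product of conjugates of \<open>h\<close> and \<open>inv h\<close>, one for every occurrence of the variable, the
conjugators \<open>b p\<close> being values of prefixes of \<open>w\<close>. Since both values of \<open>w\<close> are \<open>\<one>\<close>, this product is
trivial: a subgroup that contains all but one of the conjugates of \<open>h\<close> contains the last one too. If
\<open>w\<close> is a coset identity of minimal length, no proper subword of it is a coset identity, so, after
moving the \<open>g i\<close> within their cosets and shrinking \<open>K\<close>, all proper subwords of \<open>w\<close> take values
outside \<open>K\<close>. Then the conjugators are pairwise incongruent modulo \<open>K\<close>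
(\<open>coset_identity_dependent_conjugates\<close>).

Now let \<open>h\<close> be the Schreier generator of an edge \<open>e\<close>. Conjugation by \<open>b p\<close> turns it into the
generator of the translated edge \<open>b p e\<close>, up to factors that record how \<open>b p\<close> moves the transversal.
If the transversal comes from a spanning tree (\<open>schreier_tree_exists\<close>), these factors are products of
the generators of the translated tree edges and of one further element for each \<open>p\<close>. There are fewer
than \<open>r * n\<close> translated tree edges, where \<open>r \<le> m\<close> is the number of conjugators; all of these are kept. For
the remaining edges, every edge \<open>e\<close> gives a relation which expresses any one of the \<open>r\<close> distinct edges
\<open>b p e\<close> through the others. Choosing relations greedily, each one dealing with at most \<open>r\<close> edges of
which it removes one, discards a fraction \<open>1 / r\<close> of the remaining edges (\<open>greedy_elimination\<close>).
In total at most \<open>n * d - n * d / r + n + r\<close> generators of \<open>K\<close> suffice (\<open>few_generators\<close>), and this is small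
enough when \<open>d > 6 * m\<close> (\<open>generator_count_bound\<close>).\<close>

section \<open>Open normal subgroups of profinite groups\<close>
lemma profinite_groupD:
  assumes "profinite_group G T"
  shows "group G" "topspace T = carrier G" "compact_space T" "Hausdorff_space T"
    and "continuous_map (prod_topology T T) T (\<lambda>(x, y). x \<otimes>\<^bsub>G\<^esub> y)"
  using assms by (auto simp: profinite_group_def topological_group_def)

text \<open>In a compact Hausdorff space quasi-components are connected components, so points lying in different
components are separated by a clopen set.\<close>
lemma clopen_separation:
  assumes "compact_space T" "Hausdorff_space T" "totally_disconnected_space T"
    and "x \<in> topspace T" "y \<in> topspace T" "x \<noteq> y"
  obtains U where "openin T U" "closedin T U" "x \<in> U" "y \<notin> U"
proof -
  have "\<not> connected_component_of T x y"
  proof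
    assume "connected_component_of T x y"
    then obtain C where "connectedin T C" "x \<in> C" "y \<in> C"
      by (auto simp: connected_component_of_def)
    with assms show False
      unfolding totally_disconnected_space_def by blast
  qed
  then have "\<not> quasi_component_of T x y"
    using quasi_eq_connected_component_of[of T x] assms(1,2) by simp
  with that assms(4,5) show thesis
    unfolding quasi_component_of by blast
qed

lemma continuous_map_mult:
  assumes "profinite_group G T" "continuous_map X T f" "continuous_map X T g"
  shows "continuous_map X T (\<lambda>x. f x \<otimes>\<^bsub>G\<^esub> g x)"
proof -
  have "continuous_map X (prod_topology T T) (\<lambda>x. (f x, g x))"
    using assms by (simp add: continuous_map_pairwise comp_def)
  from continuous_map_compose[OF this profinite_groupD(5)[OF assms(1)]] show ?thesis
    by (simp add: comp_def)
qed

text \<open>The elements \<open>y\<close> whose insertion between any two factors \<open>a\<close>, \<open>b\<close> does not affect membership of the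
product in \<open>U\<close> visibly form a normal subgroup, and taking \<open>a = b = \<one>\<close> puts it inside \<open>U\<close>. The
complement is the projection to the first coordinate of a set that is closed because \<open>U\<close> is clopen; as
the other two coordinates range over a compact space, this projection is closed.\<close>
lemma open_normal_subgroup_below_clopen:
  assumes "profinite_group G T" "openin T U" "closedin T U" "\<one>\<^bsub>G\<^esub> \<in> U"
  obtains N where "open_normal N G T" "N \<subseteq> U"
proof
  note P = profinite_groupD[OF assms(1)]
  interpret group G by (rule P)
  define N where
    "N = {y \<in> carrier G. \<forall>a \<in> carrier G. \<forall>b \<in> carrier G. a \<otimes>\<^bsub>G\<^esub> y \<otimes>\<^bsub>G\<^esub> b \<in> U \<longleftrightarrow> a \<otimes>\<^bsub>G\<^esub> b \<in> U}"
  let ?X = "prod_topology T (prod_topology T T)"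
  let ?f = "\<lambda>p. fst (snd p) \<otimes>\<^bsub>G\<^esub> fst p \<otimes>\<^bsub>G\<^esub> snd (snd p)"
  let ?g = "\<lambda>p. fst (snd p) \<otimes>\<^bsub>G\<^esub> snd (snd p)"
  have "N \<lhd> G"
  proof (rule normal_invI)
    show "subgroup N G"
    proof (rule subgroupI)
      show "N \<subseteq> carrier G" "N \<noteq> {}"
        by (auto simp: N_def intro!: exI[of _ "\<one>\<^bsub>G\<^esub>"])
    next
      fix y assume y: "y \<in> N"
      have "a \<otimes>\<^bsub>G\<^esub> inv\<^bsub>G\<^esub> y \<otimes>\<^bsub>G\<^esub> b \<in> U \<longleftrightarrow> a \<otimes>\<^bsub>G\<^esub> b \<in> U" if "a \<in> carrier G" "b \<in> carrier G" for a b
      proof -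
        have "a \<otimes>\<^bsub>G\<^esub> y \<otimes>\<^bsub>G\<^esub> (inv\<^bsub>G\<^esub> y \<otimes>\<^bsub>G\<^esub> b) \<in> U \<longleftrightarrow> a \<otimes>\<^bsub>G\<^esub> (inv\<^bsub>G\<^esub> y \<otimes>\<^bsub>G\<^esub> b) \<in> U"
          using y that by (auto simp: N_def)
        moreover have "a \<otimes>\<^bsub>G\<^esub> y \<otimes>\<^bsub>G\<^esub> (inv\<^bsub>G\<^esub> y \<otimes>\<^bsub>G\<^esub> b) = a \<otimes>\<^bsub>G\<^esub> b"
          using y that by (simp add: N_def m_assoc) (simp flip: m_assoc)
        ultimately show ?thesis
          using y that by (simp add: N_def m_assoc)
      qed
      then show "inv\<^bsub>G\<^esub> y \<in> N"
        using y by (auto simp: N_def)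
    next
      fix y z assume yz: "y \<in> N" "z \<in> N"
      have "a \<otimes>\<^bsub>G\<^esub> (y \<otimes>\<^bsub>G\<^esub> z) \<otimes>\<^bsub>G\<^esub> b \<in> U \<longleftrightarrow> a \<otimes>\<^bsub>G\<^esub> b \<in> U" if "a \<in> carrier G" "b \<in> carrier G" for a b
      proof -
        have "a \<otimes>\<^bsub>G\<^esub> y \<otimes>\<^bsub>G\<^esub> (z \<otimes>\<^bsub>G\<^esub> b) \<in> U \<longleftrightarrow> a \<otimes>\<^bsub>G\<^esub> (z \<otimes>\<^bsub>G\<^esub> b) \<in> U"
          using yz that by (auto simp: N_def)
        moreover have "a \<otimes>\<^bsub>G\<^esub> z \<otimes>\<^bsub>G\<^esub> b \<in> U \<longleftrightarrow> a \<otimes>\<^bsub>G\<^esub> b \<in> U"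
          using yz that by (auto simp: N_def)
        ultimately show ?thesis
          using yz that by (simp add: N_def m_assoc)
      qed
      then show "y \<otimes>\<^bsub>G\<^esub> z \<in> N"
        using yz by (auto simp: N_def)
    qed
  next
    fix c y assume c: "c \<in> carrier G" and y: "y \<in> N"
    have "a \<otimes>\<^bsub>G\<^esub> (c \<otimes>\<^bsub>G\<^esub> y \<otimes>\<^bsub>G\<^esub> inv\<^bsub>G\<^esub> c) \<otimes>\<^bsub>G\<^esub> b \<in> U \<longleftrightarrow> a \<otimes>\<^bsub>G\<^esub> b \<in> U" if "a \<in> carrier G" "b \<in> carrier G" for a b
    proof -
      have "(a \<otimes>\<^bsub>G\<^esub> c) \<otimes>\<^bsub>G\<^esub> y \<otimes>\<^bsub>G\<^esub> (inv\<^bsub>G\<^esub> c \<otimes>\<^bsub>G\<^esub> b) \<in> U \<longleftrightarrow> (a \<otimes>\<^bsub>G\<^esub> c) \<otimes>\<^bsub>G\<^esub> (inv\<^bsub>G\<^esub> c \<otimes>\<^bsub>G\<^esub> b) \<in> U"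
        using y c that by (auto simp: N_def)
      moreover have "(a \<otimes>\<^bsub>G\<^esub> c) \<otimes>\<^bsub>G\<^esub> (inv\<^bsub>G\<^esub> c \<otimes>\<^bsub>G\<^esub> b) = a \<otimes>\<^bsub>G\<^esub> b"
        using c that by (metis inv_closed inv_solve_left' m_assoc m_closed)
      ultimately show ?thesis
        using c y that by (simp add: N_def m_assoc)
    qed
    then show "c \<otimes>\<^bsub>G\<^esub> y \<otimes>\<^bsub>G\<^esub> inv\<^bsub>G\<^esub> c \<in> N"
      using c y by (auto simp: N_def)
  qed
  moreover have "openin T N"
  proof -
    have cont: "continuous_map ?X T ?f" "continuous_map ?X T ?g"
      by (intro continuous_map_mult[OF assms(1)] continuous_map_of_fst[THEN iffD2] continuous_map_of_snd[THEN iffD2] continuous_map_fst continuous_map_snd continuous_map_compose[OF continuous_map_snd continuous_map_fst, unfolded comp_def] continuous_map_compose[OF continuous_map_snd continuous_map_snd, unfolded comp_def])+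
    let ?bad = "{p \<in> topspace ?X. ?f p \<in> U} \<inter> {p \<in> topspace ?X. ?g p \<in> topspace T - U}
        \<union> {p \<in> topspace ?X. ?f p \<in> topspace T - U} \<inter> {p \<in> topspace ?X. ?g p \<in> U}"
    have "closedin ?X ?bad"
      by (intro closedin_Un closedin_Int closedin_continuous_map_preimage[OF cont(1)]
          closedin_continuous_map_preimage[OF cont(2)] assms(3) closedin_diff closedin_topspace assms(2))
    moreover have "compact_space (prod_topology T T)"
      using P(3) by (simp add: compact_space_prod_topology)
    ultimately have "closedin T (fst ` ?bad)"
      using closed_map_fst[of "prod_topology T T" T] unfolding closed_map_def by blast
    moreover have "?bad = {p \<in> topspace ?X. ?f p \<in> U \<longleftrightarrow> ?g p \<notin> U}"
      using continuous_map_funspace[OF cont(1)] continuous_map_funspace[OF cont(2)] by blast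
    moreover have "N = topspace T - fst ` {p \<in> topspace ?X. ?f p \<in> U \<longleftrightarrow> ?g p \<notin> U}"
    proof (intro equalityI subsetI)
      fix y assume "y \<in> N"
      then show "y \<in> topspace T - fst ` {p \<in> topspace ?X. ?f p \<in> U \<longleftrightarrow> ?g p \<notin> U}"
        using P(2) by (auto simp: N_def)
    next
      fix y assume y: "y \<in> topspace T - fst ` {p \<in> topspace ?X. ?f p \<in> U \<longleftrightarrow> ?g p \<notin> U}"
      have "a \<otimes>\<^bsub>G\<^esub> y \<otimes>\<^bsub>G\<^esub> b \<in> U \<longleftrightarrow> a \<otimes>\<^bsub>G\<^esub> b \<in> U" if "a \<in> carrier G" "b \<in> carrier G" for a b
      proof -
        have "(y, a, b) \<notin> {p \<in> topspace ?X. ?f p \<in> U \<longleftrightarrow> ?g p \<notin> U}"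
          using y by force
        then show ?thesis
          using y that P(2) by simp
      qed
      then show "y \<in> N"
        using y P(2) by (simp add: N_def)
    qed
    ultimately show "openin T N"
      by (simp add: openin_diff)
  qed
  ultimately show "open_normal N G T"
    by (simp add: open_normal_def)
  show "N \<subseteq> U"
  proof
    fix y assume "y \<in> N"
    then have "\<one>\<^bsub>G\<^esub> \<otimes>\<^bsub>G\<^esub> y \<otimes>\<^bsub>G\<^esub> \<one>\<^bsub>G\<^esub> \<in> U \<longleftrightarrow> \<one>\<^bsub>G\<^esub> \<otimes>\<^bsub>G\<^esub> \<one>\<^bsub>G\<^esub> \<in> U" "y \<in> carrier G"
      unfolding N_def by blast+
    then show "y \<in> U" using assms(4) by simp
  qed
qed

lemma open_normal_subgroup_avoiding:
  assumes "profinite_group G T" "x \<in> carrier G" "x \<noteq> \<one>\<^bsub>G\<^esub>"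
  obtains N where "open_normal N G T" "x \<notin> N"
proof -
  note P = profinite_groupD[OF assms(1)]
  interpret group G by (rule P)
  obtain U where "openin T U" "closedin T U" "\<one>\<^bsub>G\<^esub> \<in> U" "x \<notin> U"
    using clopen_separation[of T "\<one>\<^bsub>G\<^esub>" x] assms P by (metis one_closed profinite_group_def)
  then show thesis
    using that open_normal_subgroup_below_clopen[OF assms(1)] by (metis subsetD)
qed

lemma open_normal_Int:
  assumes "group G" "open_normal K G T" "open_normal L G T"
  shows "open_normal (K \<inter> L) G T"
  using assms group.normal_subgroup_intersect unfolding open_normal_def by blast

lemma openin_rcoset:
  assumes "profinite_group G T" "open_normal K G T" "x \<in> carrier G"
  shows "openin T (K #>\<^bsub>G\<^esub> x)"
proof -
  note P = profinite_groupD[OF assms(1)]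
  interpret normal K G using assms(2) by (simp add: open_normal_def)
  have "continuous_map T T (\<lambda>y. y \<otimes>\<^bsub>G\<^esub> inv\<^bsub>G\<^esub> x)"
    using assms(3) P(2) by (intro continuous_map_mult[OF assms(1)]) auto
  then have "openin T {y \<in> topspace T. y \<otimes>\<^bsub>G\<^esub> inv\<^bsub>G\<^esub> x \<in> K}"
    using assms(2) openin_continuous_map_preimage unfolding open_normal_def by blast
  moreover have "{y \<in> topspace T. y \<otimes>\<^bsub>G\<^esub> inv\<^bsub>G\<^esub> x \<in> K} = K #>\<^bsub>G\<^esub> x"
    using assms(3) P(2) rcos_module[OF is_group assms(3)] elemrcos_carrier[OF is_group assms(3)] by blast
  ultimately show ?thesis by simp
qed

lemma finite_rcosets:
  assumes "profinite_group G T" "open_normal K G T"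
  shows "finite (rcosets\<^bsub>G\<^esub> K)"
proof -
  note P = profinite_groupD[OF assms(1)]
  interpret normal K G using assms(2) by (simp add: open_normal_def)
  have op: "\<forall>C \<in> rcosets\<^bsub>G\<^esub> K. openin T C"
    using openin_rcoset[OF assms] by (auto simp: RCOSETS_def)
  have "topspace T \<subseteq> \<Union>(rcosets\<^bsub>G\<^esub> K)"
    using rcosets_part_G[OF is_subgroup] P(2) by simp
  then obtain F where F: "finite F" "F \<subseteq> rcosets\<^bsub>G\<^esub> K" "topspace T \<subseteq> \<Union>F"
    using P(3)[unfolded compact_space_alt, rule_format, OF conjI[OF op]] by blast
  have "rcosets\<^bsub>G\<^esub> K \<subseteq> F"
  proof
    fix C assume C: "C \<in> rcosets\<^bsub>G\<^esub> K"
    then obtain x where "x \<in> C" using rcosets_non_empty by blast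
    moreover have "x \<in> carrier G"
      using C \<open>x \<in> C\<close> rcosets_part_G[OF is_subgroup] by blast
    then obtain D where "D \<in> F" "x \<in> D"
      using F(3) P(2) by auto
    moreover have "D = C"
      using pairwiseD[OF rcos_disjoint[OF is_subgroup], of C D] C F(2) \<open>x \<in> C\<close> \<open>x \<in> D\<close> \<open>D \<in> F\<close>
      by (auto simp: disjnt_def)
    ultimately show "C \<in> F" using \<open>D \<in> F\<close> by simp
  qed
  then show ?thesis using F(1) finite_subset by blast
qed

section \<open>Greedy elimination along relations\<close>
text \<open>A set \<open>R \<in> \<R>\<close> stands for a relation that expresses any one of its elements through the others. Pick \<open>R\<close>
meeting \<open>X\<close>, discard one element of \<open>X \<inter> R\<close> and keep the others, then go on with \<open>X - R\<close>. The elements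
kept now recover the discarded one, hence all of \<open>R\<close>, before the relations chosen for \<open>X - R\<close> need them.
Each step discards one element and removes at most \<open>r\<close> elements from \<open>X\<close>.\<close>
lemma greedy_elimination:
  assumes "finite X" "X \<subseteq> \<Union>\<R>" "\<And>R. R \<in> \<R> \<Longrightarrow> finite R \<and> card R \<le> r"
  shows "\<exists>Y \<subseteq> X. r * card Y + card X \<le> r * card X \<and>
    (\<forall>C. (\<forall>R \<in> \<R>. \<forall>e \<in> R. R - {e} \<subseteq> C \<longrightarrow> e \<in> C) \<longrightarrow> Y \<subseteq> C \<longrightarrow> \<Union>\<R> - X \<subseteq> C \<longrightarrow> X \<subseteq> C)"
  using assms(1,2)
proof (induction "card X" arbitrary: X rule: less_induct)
  case less
  show ?case
  proof (cases "X = {}")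
    case False
    then obtain x R where xR: "x \<in> X" "x \<in> R" "R \<in> \<R>"
      using less.prems(2) by blast
    have fin: "finite (X - R)" "finite (X \<inter> R)" using less.prems(1) by auto
    have split: "card X = card (X - R) + card (X \<inter> R)"
      using card_Diff_subset_Int[of X R] fin card_mono[OF less.prems(1), of "X \<inter> R"] by simp
    have pos: "0 < card (X \<inter> R)" using xR fin by (auto simp: card_gt_0_iff)
    have small: "card (X \<inter> R) \<le> r"
      using assms(3)[OF xR(3)] card_mono[of R "X \<inter> R"] by simp
    have "card (X - R) < card X" using pos split by linarith
    with less.hyps[of "X - R"] fin(1) less.prems(2)
    obtain Y where Y: "Y \<subseteq> X - R" "r * card Y + card (X - R) \<le> r * card (X - R)"
      and closed: "\<And>C. \<forall>R \<in> \<R>. \<forall>e \<in> R. R - {e} \<subseteq> C \<longrightarrow> e \<in> C \<Longrightarrow> Y \<subseteq> C \<Longrightarrow> \<Union>\<R> - (X - R) \<subseteq> C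
        \<Longrightarrow> X - R \<subseteq> C"
      by blast
    let ?Y = "Y \<union> (X \<inter> R - {x})"
    have "card ?Y = card Y + (card (X \<inter> R) - 1)"
      using Y(1) xR fin finite_subset[OF Y(1) fin(1)]
      by (subst card_Un_disjoint) (auto simp: card_Diff_singleton)
    then have "r * card ?Y + card X \<le> r * card X"
      using Y(2) pos small split by (cases "card (X \<inter> R)") (auto simp: algebra_simps)
    moreover have "X \<subseteq> C"
      if C: "\<forall>R \<in> \<R>. \<forall>e \<in> R. R - {e} \<subseteq> C \<longrightarrow> e \<in> C" "?Y \<subseteq> C" "\<Union>\<R> - X \<subseteq> C" for C
    proof -
      have "R - {x} \<subseteq> C" using C(2,3) xR(3) by blast
      then have "R \<subseteq> C" using C(1) xR(2,3) by blast
      moreover have "X - R \<subseteq> C"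
        using \<open>R \<subseteq> C\<close> C by (intro closed) auto
      ultimately show ?thesis by blast
    qed
    moreover have "?Y \<subseteq> X" using Y(1) by blast
    ultimately show ?thesis by blast
  qed auto
qed

section \<open>Schreier generators of a normal subgroup\<close>
locale normal_transversal = normal K G for K and G (structure) +
  fixes R :: "'a set"
  assumes transversal_subset: "R \<subseteq> carrier G"
    and one_in_transversal: "\<one> \<in> R"
    and ex1_representative: "x \<in> carrier G \<Longrightarrow> \<exists>!t. t \<in> R \<and> K #> t = K #> x"
begin

definition rep :: "'a \<Rightarrow> 'a" where
  "rep x = (THE t. t \<in> R \<and> K #> t = K #> x)"

text \<open>For \<open>x\<close> in the transversal and a generator \<open>y\<close> this is the Schreier generator of the edge \<open>(x, y)\<close>. Arbitrary
\<open>x\<close> are allowed because \<open>defect b v\<close> also measures how left translation by \<open>b\<close> moves the transversal.\<close>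
definition defect :: "'a \<Rightarrow> 'a \<Rightarrow> 'a" where
  "defect x y = x \<otimes> y \<otimes> inv (rep (x \<otimes> y))"

lemma rep_in [simp]: "x \<in> carrier G \<Longrightarrow> rep x \<in> R"
  and rep_coset [simp]: "x \<in> carrier G \<Longrightarrow> K #> rep x = K #> x"
  using theI'[OF ex1_representative, of x] by (auto simp: rep_def)

lemma in_carrier [simp]: "t \<in> R \<Longrightarrow> t \<in> carrier G"
  using transversal_subset by blast

lemma rep_eq: "x \<in> carrier G \<Longrightarrow> y \<in> carrier G \<Longrightarrow> K #> x = K #> y \<Longrightarrow> rep x = rep y"
  by (simp add: rep_def)

lemma rep_eq_iff: "x \<in> carrier G \<Longrightarrow> y \<in> carrier G \<Longrightarrow> rep x = rep y \<longleftrightarrow> K #> x = K #> y"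
  using rep_eq rep_coset by metis

lemma rep_id [simp]: "t \<in> R \<Longrightarrow> rep t = t"
  using ex1_representative[of t] rep_in[of t] rep_coset[of t] in_carrier by blast

lemma rep_mult_left [simp]:
  "x \<in> carrier G \<Longrightarrow> y \<in> carrier G \<Longrightarrow> rep (rep x \<otimes> y) = rep (x \<otimes> y)"
  by (intro rep_eq) (simp_all flip: rcos_sum)

lemma rep_mult_right [simp]:
  "x \<in> carrier G \<Longrightarrow> y \<in> carrier G \<Longrightarrow> rep (x \<otimes> rep y) = rep (x \<otimes> y)"
  by (intro rep_eq) (simp_all flip: rcos_sum)

lemma defect_closed [simp]: "x \<in> carrier G \<Longrightarrow> y \<in> carrier G \<Longrightarrow> defect x y \<in> carrier G"
  by (simp add: defect_def)

lemma defect_in: "x \<in> carrier G \<Longrightarrow> y \<in> carrier G \<Longrightarrow> defect x y \<in> K"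
  unfolding defect_def
  by (rule rcos_module_imp[OF is_group]) (simp_all add: rcos_self is_subgroup)

text \<open>The cocycle identity: the defect of a path in the Schreier graph is the product of the defects of
its edges.\<close>
lemma defect_mult:
  assumes "x \<in> carrier G" "y \<in> carrier G" "z \<in> carrier G"
  shows "defect x (y \<otimes> z) = defect x y \<otimes> defect (rep (x \<otimes> y)) z"
  using assms by (simp add: defect_def m_assoc inv_solve_left' inv_solve_left)

text \<open>Conjugation by \<open>b\<close> carries the Schreier generator of an edge to that of the translated edge, up to the
defects of \<open>b\<close> at the two ends of the edge.\<close>
lemma conjugate_defect:
  assumes "b \<in> carrier G" "v \<in> carrier G" "s \<in> carrier G"
  shows "b \<otimes> defect v s \<otimes> inv b =
    defect b v \<otimes> defect (rep (b \<otimes> v)) s \<otimes> inv (defect b (rep (v \<otimes> s)))"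
proof -
  have "defect b v \<otimes> defect (rep (b \<otimes> v)) s = defect b (v \<otimes> s)"
    using assms by (simp add: defect_mult)
  moreover have "inv x \<otimes> (x \<otimes> y) = y" if "x \<in> carrier G" "y \<in> carrier G" for x y
    using that by (simp flip: m_assoc)
  ultimately show ?thesis
    using assms by (simp add: defect_def inv_mult_group m_assoc)
qed

text \<open>Schreier's lemma: by the cocycle identity, \<open>M\<close> contains all defects \<open>defect v y\<close> with \<open>y\<close> generated by \<open>S\<close>,
and \<open>defect \<one> y = y\<close> for \<open>y \<in> K\<close>.\<close>
lemma generate_Int_subset:
  assumes "subgroup M G" "S \<subseteq> carrier G" "\<And>v s. v \<in> R \<Longrightarrow> s \<in> S \<Longrightarrow> defect v s \<in> M"
  shows "generate G S \<inter> K \<subseteq> M"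
proof -
  interpret M: subgroup M G by fact
  have key: "defect v y \<in> M" if "y \<in> generate G S" "v \<in> R" for y v
    using that
  proof (induction arbitrary: v rule: generate.induct)
    case one
    then show ?case by (simp add: defect_def)
  next
    case (incl h)
    then show ?case using assms(3) by blast
  next
    case (inv h)
    then have h: "h \<in> carrier G" using assms(2) by blast
    let ?u = "rep (v \<otimes> inv h)"
    have "defect ?u h \<in> M" using inv h assms(3) by simp
    moreover have "rep (v \<otimes> inv h \<otimes> h) = v"
      using inv h by (simp add: m_assoc)
    then have "defect v (inv h) = inv (defect ?u h)"
      using inv h by (simp add: defect_def inv_mult_group m_assoc)
    ultimately show ?case by simp
  next
    case (eng h1 h2)
    then have h: "h1 \<in> carrier G" "h2 \<in> carrier G"
      using generate_in_carrier[OF assms(2)] by blast+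
    with eng show ?case by (simp add: defect_mult)
  qed
  show ?thesis
  proof
    fix y assume y: "y \<in> generate G S \<inter> K"
    then have "rep y = rep \<one>"
      by (intro rep_eq) (auto simp: rcos_const[OF is_group])
    then have "rep y = \<one>" using one_in_transversal by simp
    moreover have "defect \<one> y \<in> M" using key y one_in_transversal by blast
    ultimately show "y \<in> M" using y by (simp add: defect_def)
  qed
qed

end

text \<open>The edge set \<open>E\<close> joins all vertices of \<open>V\<close> to the root \<open>\<one>\<close>. Connectedness is phrased as an induction
principle: a set of group elements that contains the root and does not separate the ends of any edge
contains \<open>V\<close>.\<close>
definition schreier_tree :: "('a, 'b) monoid_scheme \<Rightarrow> 'a set \<Rightarrow> 'a set \<Rightarrow> ('a \<times> 'a) set \<Rightarrow> bool" where
  "schreier_tree G S V E \<longleftrightarrow>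
     E \<subseteq> V \<times> S \<and> finite E \<and> card E < card V \<and> (\<forall>(v, s) \<in> E. v \<otimes>\<^bsub>G\<^esub> s \<in> V) \<and>
     (\<forall>A. \<one>\<^bsub>G\<^esub> \<in> A \<longrightarrow> (\<forall>(v, s) \<in> E. v \<in> A \<longleftrightarrow> v \<otimes>\<^bsub>G\<^esub> s \<in> A) \<longrightarrow> V \<subseteq> A)"

text \<open>The new edge may be directed either way, because a generating set need not contain the inverses of its
elements.\<close>
lemma schreier_tree_extend:
  assumes "schreier_tree G S V E" "finite V" "u \<notin> V" "v \<in> V" "s \<in> S"
    and "(a, b) = (v, u) \<or> (a, b) = (u, v)" "a \<otimes>\<^bsub>G\<^esub> s = b"
  shows "schreier_tree G S (insert u V) (insert (a, s) E)"
proof -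
  have "V \<subseteq> A \<and> u \<in> A"
    if "\<one>\<^bsub>G\<^esub> \<in> A" "\<forall>(v, s) \<in> insert (a, s) E. v \<in> A \<longleftrightarrow> v \<otimes>\<^bsub>G\<^esub> s \<in> A" for A
  proof -
    have "V \<subseteq> A"
      using assms(1) that unfolding schreier_tree_def by simp
    then show ?thesis using that(2) assms(4,6,7) by auto
  qed
  moreover have "card (insert (a, s) E) < card (insert u V)"
    using assms(1-3) card_insert_le_m1 by (auto simp: schreier_tree_def card_insert_if)
  moreover have "insert (a, s) E \<subseteq> insert u V \<times> S" "finite (insert (a, s) E)"
    using assms by (auto simp: schreier_tree_def)
  moreover have "\<forall>(v, s) \<in> insert (a, s) E. v \<otimes>\<^bsub>G\<^esub> s \<in> insert u V"
    using assms(1,4,6,7) by (auto simp: schreier_tree_def)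
  ultimately show ?thesis
    unfolding schreier_tree_def by blast
qed

text \<open>Take a tree with as many vertices as possible among those with at most one vertex in each coset. If
neither a generator nor its inverse leads out of the union \<open>W\<close> of its cosets, then \<open>W\<close> is closed under
right multiplication by the generated subgroup, which meets every coset; so the tree is a transversal.\<close>
lemma (in normal) schreier_tree_exists:
  assumes fin: "finite (rcosets H)" and S: "S \<subseteq> carrier G"
    and meets: "\<And>x. x \<in> carrier G \<Longrightarrow> generate G S \<inter> (H #> x) \<noteq> {}"
  obtains V E where "normal_transversal H G V" "schreier_tree G S V E" "card V = card (rcosets H)"
proof -
  define partial where "partial V \<longleftrightarrow> V \<subseteq> carrier G \<and> finite V \<and> \<one> \<in> V \<and> inj_on (\<lambda>t. H #> t) V \<and>
    (\<exists>E. schreier_tree G S V E)" for V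
  have "partial {\<one>}"
    by (auto simp: partial_def schreier_tree_def intro!: exI[of _ "{}"])
  moreover have bound: "card V \<le> card (rcosets H)" if "partial V" for V
    using that by (intro card_inj_on_le[where f = "\<lambda>t. H #> t", OF _ _ fin]) (auto simp: partial_def RCOSETS_def)
  then have "\<forall>V. partial V \<longrightarrow> card V < Suc (card (rcosets H))" by (auto simp: less_Suc_eq_le)
  ultimately obtain V where V: "partial V" and maximal: "\<And>V'. partial V' \<Longrightarrow> card V' \<le> card V"
    using ex_has_greatest_nat[of partial "{\<one>}" card] by blast
  then obtain E where E: "schreier_tree G S V E"
    by (auto simp: partial_def)
  have V': "V \<subseteq> carrier G" "finite V" "\<one> \<in> V" "inj_on (\<lambda>t. H #> t) V"
    using V by (auto simp: partial_def)
  define W where "W = {x \<in> carrier G. H #> x \<in> (\<lambda>t. H #> t) ` V}"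
  have no_new: "u \<in> W"
    if "u \<in> carrier G" "v \<in> V" "s \<in> S" "(a, b) = (v, u) \<or> (a, b) = (u, v)" "a \<otimes> s = b" for u v s a b
  proof (rule ccontr)
    assume "u \<notin> W"
    then have new: "H #> u \<notin> (\<lambda>t. H #> t) ` V" using that(1) by (simp add: W_def)
    then have "u \<notin> V" by blast
    then have "schreier_tree G S (insert u V) (insert (a, s) E)"
      by (intro schreier_tree_extend[OF E V'(2) _ that(2-5)])
    moreover have "inj_on (\<lambda>t. H #> t) (insert u V)"
      using V'(4) new by auto
    ultimately have "partial (insert u V)"
      using V' that(1) unfolding partial_def by blast
    then show False using maximal[of "insert u V"] \<open>u \<notin> V\<close> V'(2) by simp
  qed
  have W_step: "x \<otimes> s \<in> W \<and> x \<otimes> inv s \<in> W" if x: "x \<in> W" and s: "s \<in> S" for x s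
  proof -
    obtain v where v: "v \<in> V" "H #> x = H #> v" using x by (auto simp: W_def)
    have car: "x \<in> carrier G" "s \<in> carrier G" "v \<in> carrier G"
      using x s v S V' by (auto simp: W_def)
    have "v \<otimes> s \<in> W"
      using no_new[OF _ v(1) s, of _ v "v \<otimes> s"] car by simp
    moreover have "v \<otimes> inv s \<otimes> s = v"
      using car by (simp add: m_assoc)
    then have "v \<otimes> inv s \<in> W"
      using no_new[OF _ v(1) s, of _ "v \<otimes> inv s" v] car by simp
    moreover have "H #> (x \<otimes> s) = H #> (v \<otimes> s)" "H #> (x \<otimes> inv s) = H #> (v \<otimes> inv s)"
      using car v(2) by (simp_all flip: rcos_sum)
    ultimately show ?thesis using car by (simp add: W_def)
  qed
  have gen: "x \<otimes> y \<in> W" if "y \<in> generate G S" "x \<in> W" for x y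
    using that
  proof (induction arbitrary: x rule: generate.induct)
    case one
    then show ?case by (simp add: W_def)
  next
    case (incl h)
    then show ?case using W_step by blast
  next
    case (inv h)
    then show ?case using W_step by blast
  next
    case (eng h1 h2)
    then have "h1 \<in> carrier G" "h2 \<in> carrier G" "x \<in> carrier G"
      using generate_in_carrier[OF S] by (auto simp: W_def)
    then have "x \<otimes> (h1 \<otimes> h2) = x \<otimes> h1 \<otimes> h2" by (simp add: m_assoc)
    then show ?case using eng by simp
  qed
  have onto: "H #> x \<in> (\<lambda>t. H #> t) ` V" if x: "x \<in> carrier G" for x
  proof -
    obtain y where y: "y \<in> generate G S" "y \<in> H #> x" using meets[OF x] by blast
    have "\<one> \<in> W" using V' by (auto simp: W_def)
    then have "\<one> \<otimes> y \<in> W" using gen y(1) by blast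
    moreover have "y \<in> carrier G" using y(1) generate_in_carrier[OF S] by blast
    ultimately have "H #> y \<in> (\<lambda>t. H #> t) ` V" by (simp add: W_def)
    then show ?thesis by (simp only: repr_independence[OF y(2) x is_subgroup])
  qed
  have "normal_transversal H G V"
  proof unfold_locales
    fix x assume "x \<in> carrier G"
    then show "\<exists>!t. t \<in> V \<and> H #> t = H #> x"
      using onto[of x] inj_onD[OF V'(4)] by blast
  qed (use V' in auto)
  moreover have "(\<lambda>t. H #> t) ` V = rcosets H"
    using onto V'(1) by (auto simp: RCOSETS_def)
  then have "card V = card (rcosets H)" using card_image[OF V'(4)] by simp
  ultimately show thesis using that E by blast
qed

section \<open>Generators made redundant by dependent conjugates\<close>
lemma (in subgroup) mult_in_iff:
  assumes "group G" "x \<in> H" "a \<in> carrier G"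
  shows "a \<otimes> x \<in> H \<longleftrightarrow> a \<in> H" "x \<otimes> a \<in> H \<longleftrightarrow> a \<in> H"
proof -
  interpret group G by fact
  have x: "x \<in> carrier G" "inv x \<in> H" using assms(2) by simp_all
  have closed: "y \<otimes> z \<in> H" if "y \<in> H" "z \<in> H" for y z
    using that by (rule subgroup.m_closed[OF subgroup_axioms])
  have "a = (a \<otimes> x) \<otimes> inv x" "a = inv x \<otimes> (x \<otimes> a)"
    using assms(3) x(1) by (simp_all add: m_assoc) (simp flip: m_assoc)
  then have "a \<in> H" if "a \<otimes> x \<in> H \<or> x \<otimes> a \<in> H"
    using closed[OF _ x(2), of "a \<otimes> x"] closed[OF x(2), of "x \<otimes> a"] that by auto
  then show "a \<otimes> x \<in> H \<longleftrightarrow> a \<in> H" "x \<otimes> a \<in> H \<longleftrightarrow> a \<in> H"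
    using closed assms(2) by blast+
qed

text \<open>What a coset identity says about a single element \<open>h\<close> of \<open>K\<close>: some product that contains each conjugate
\<open>b p \<otimes> h \<otimes> inv (b p)\<close>, or its inverse, exactly once is trivial. Recorded is the consequence that lets
any one of the conjugates be eliminated.\<close>
definition dependent_conjugates ::
    "('a, 'b) monoid_scheme \<Rightarrow> 'a set \<Rightarrow> 'i set \<Rightarrow> ('i \<Rightarrow> 'a) \<Rightarrow> bool" where
  "dependent_conjugates G K P b \<longleftrightarrow>
     (\<forall>M h p. subgroup M G \<longrightarrow> h \<in> K \<longrightarrow> p \<in> P \<longrightarrow>
       (\<forall>q \<in> P - {p}. b q \<otimes>\<^bsub>G\<^esub> h \<otimes>\<^bsub>G\<^esub> inv\<^bsub>G\<^esub> b q \<in> M) \<longrightarrow> b p \<otimes>\<^bsub>G\<^esub> h \<otimes>\<^bsub>G\<^esub> inv\<^bsub>G\<^esub> b p \<in> M)"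

context normal_transversal
begin

text \<open>Edges of the Schreier graph are translated by the group elements \<open>b p\<close>. The set \<open>Z\<close> consists of the
defects of the \<open>b p\<close> at the root, the Schreier generators of the translates \<open>B\<close> of the tree edges, and
those of a greedily chosen part \<open>Y\<close> of the other edges. Walking along the translated tree shows that the
subgroup generated by \<open>Z\<close> contains all defects of the \<open>b p\<close> on the transversal. Modulo these, the
conjugates of the generator of an edge are the generators of its translates, which are distinct
edges since the \<open>b p\<close> are incongruent modulo \<open>K\<close>; hence the dependence of the conjugates is a relation
between edges, as needed for the greedy elimination.\<close>
lemma few_generators:
  assumes fin: "finite R" "finite S" "finite P" and S: "S \<subseteq> carrier G" and tree: "schreier_tree G S R E"
    and P: "P \<noteq> {}" "b ` P \<subseteq> carrier G" "inj_on (\<lambda>p. K #> b p) P" "dependent_conjugates G K P b"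
  shows "\<exists>Z \<subseteq> K. finite Z \<and> generate G S \<inter> K \<subseteq> generate G Z \<and>
    card P * card Z + card R * card S \<le> card P * (card R * card S + card R + card P)"
proof -
  have b: "b p \<in> carrier G" if "p \<in> P" for p using P(2) that by blast
  let ?tr = "\<lambda>v s p. (rep (b p \<otimes> v), s)"
  define \<R> where "\<R> = (\<lambda>(v, s). ?tr v s ` P) ` (R \<times> S)"
  define B where "B = (\<lambda>(p, v, s). ?tr v s p) ` (P \<times> E)"
  define X where "X = R \<times> S - B"
  have E: "E \<subseteq> R \<times> S" "finite E" "card E < card R"
    using tree by (auto simp: schreier_tree_def)
  have connected: "R \<subseteq> A" if "\<one> \<in> A" "\<forall>(v, s) \<in> E. v \<in> A \<longleftrightarrow> v \<otimes> s \<in> A" for A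
    using tree that by (simp add: schreier_tree_def)
  have B: "B \<subseteq> R \<times> S" "finite B" "card B \<le> card P * card R"
  proof -
    show "B \<subseteq> R \<times> S" using E b by (auto simp: B_def)
    show "finite B" using fin E by (simp add: B_def)
    have "card B \<le> card (P \<times> E)"
      unfolding B_def using fin E by (intro card_image_le) simp
    also have "\<dots> \<le> card P * card R" using E by (simp add: card_cartesian_product)
    finally show "card B \<le> card P * card R" .
  qed
  \<comment> \<open>Translating an edge back by some \<open>b p\<close> gives an edge whose relation involves it.\<close>
  have "X \<subseteq> \<Union>\<R>"
  proof
    fix e assume "e \<in> X"
    then obtain u s where e: "e = (u, s)" "u \<in> R" "s \<in> S" by (auto simp: X_def)
    obtain p where p: "p \<in> P" using P(1) by blast
    let ?v = "rep (inv (b p) \<otimes> u)"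
    have "rep (b p \<otimes> ?v) = u"
      using e b[OF p] by (simp flip: m_assoc)
    then have "e \<in> ?tr ?v s ` P" using p e(1) by (intro image_eqI[of _ _ p]) auto
    moreover have "?v \<in> R" using b[OF p] e by simp
    ultimately show "e \<in> \<Union>\<R>" using e(3) by (auto simp: \<R>_def)
  qed
  moreover have "finite Q \<and> card Q \<le> card P" if "Q \<in> \<R>" for Q
    using that fin by (auto simp: \<R>_def card_image_le)
  moreover have "finite X" using fin by (simp add: X_def)
  ultimately obtain Y where Y: "Y \<subseteq> X" "card P * card Y + card X \<le> card P * card X"
    and closed: "\<And>C. \<forall>Q \<in> \<R>. \<forall>e \<in> Q. Q - {e} \<subseteq> C \<longrightarrow> e \<in> C \<Longrightarrow> Y \<subseteq> C \<Longrightarrow> \<Union>\<R> - X \<subseteq> C \<Longrightarrow> X \<subseteq> C"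
    using greedy_elimination[of X \<R> "card P"] by blast
  define Z where "Z = (\<lambda>(v, s). defect v s) ` (Y \<union> B) \<union> (\<lambda>p. defect (b p) \<one>) ` P"
  have YB: "Y \<union> B \<subseteq> R \<times> S" "finite (Y \<union> B)"
    using Y(1) B(1,2) fin finite_subset[of Y "R \<times> S"] by (auto simp: X_def)
  have "Z \<subseteq> K"
    using YB(1) S b by (auto simp: Z_def intro!: defect_in)
  moreover have "finite Z" using YB(2) fin by (simp add: Z_def)
  moreover have "card P * card Z + card R * card S \<le> card P * (card R * card S + card R + card P)"
  proof -
    have "card Z \<le> card ((\<lambda>(v, s). defect v s) ` (Y \<union> B)) + card ((\<lambda>p. defect (b p) \<one>) ` P)"
      unfolding Z_def by (rule card_Un_le)
    also have "\<dots> \<le> card (Y \<union> B) + card P"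
      by (intro add_mono card_image_le fin YB)
    also have "\<dots> \<le> card Y + card B + card P"
      by (simp add: card_Un_le)
    finally have "card P * card Z \<le> card P * (card Y + card B + card P)" by simp
    moreover have X: "card X + card B = card R * card S"
      using card_Diff_subset[OF B(2,1)] card_mono[OF _ B(1)] fin by (simp add: X_def card_cartesian_product)
    moreover have "card P * card X + card P * card B = card P * (card R * card S)"
      by (simp flip: X add: distrib_left)
    ultimately show ?thesis using Y(2) B(3) unfolding distrib_left by linarith
  qed
  moreover have "generate G S \<inter> K \<subseteq> generate G Z"
  proof -
    define M where "M = generate G Z"
    have Zc: "Z \<subseteq> carrier G" using \<open>Z \<subseteq> K\<close> subset by blast
    have M: "subgroup M G" unfolding M_def by (rule generate_is_subgroup[OF Zc])
    interpret M: subgroup M G by (rule M)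
    have gens: "Z \<subseteq> M" unfolding M_def by (auto intro: generate.incl)
    define C where "C = {(v, s). v \<in> R \<and> s \<in> S \<and> defect v s \<in> M}"
    have YB_C: "Y \<union> B \<subseteq> C"
      using YB(1) gens by (auto simp: C_def Z_def)
    \<comment> \<open>Membership of the defect in \<open>M\<close> propagates from the root along the tree.\<close>
    have path: "defect (b p) v \<in> M" if p: "p \<in> P" and v: "v \<in> R" for p v
    proof -
      let ?A = "{v \<in> carrier G. defect (b p) v \<in> M}"
      have "\<one> \<in> ?A" using gens p by (auto simp: Z_def)
      moreover have "\<forall>(v, s) \<in> E. v \<in> ?A \<longleftrightarrow> v \<otimes> s \<in> ?A"
      proof clarify
        fix v s assume e: "(v, s) \<in> E"
        then have c: "v \<in> carrier G" "s \<in> carrier G" using E S by auto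
        have "?tr v s p \<in> B"
          unfolding B_def using p e by (intro image_eqI[of _ _ "(p, v, s)"]) auto
        then have "?tr v s p \<in> C" using YB_C by blast
        then have "defect (rep (b p \<otimes> v)) s \<in> M" by (simp add: C_def)
        then show "v \<in> ?A \<longleftrightarrow> v \<otimes> s \<in> ?A"
          using c b[OF p] by (simp add: defect_mult M.mult_in_iff(1)[OF is_group])
      qed
      ultimately have "R \<subseteq> ?A" by (rule connected)
      then show ?thesis using v by blast
    qed
    have translate: "b p \<otimes> defect v s \<otimes> inv (b p) \<in> M \<longleftrightarrow> ?tr v s p \<in> C"
      if "p \<in> P" "v \<in> R" "s \<in> S" for p v s
    proof -
      have c: "v \<in> carrier G" "s \<in> carrier G" "b p \<in> carrier G" using that S b by auto
      show ?thesis
        using that c path[OF that(1)]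
        by (simp add: conjugate_defect C_def M.mult_in_iff[OF is_group])
    qed
    have "\<forall>Q \<in> \<R>. \<forall>e \<in> Q. Q - {e} \<subseteq> C \<longrightarrow> e \<in> C"
    proof (intro ballI impI)
      fix Q e assume "Q \<in> \<R>" "e \<in> Q" and rest: "Q - {e} \<subseteq> C"
      then obtain v s p where vs: "v \<in> R" "s \<in> S" "p \<in> P" and Q: "Q = ?tr v s ` P" and e: "e = ?tr v s p"
        by (auto simp: \<R>_def)
      have others: "b q \<otimes> defect v s \<otimes> inv (b q) \<in> M" if q: "q \<in> P" "q \<noteq> p" for q
      proof -
        have "K #> (b q \<otimes> v) \<noteq> K #> (b p \<otimes> v)"
        proof
          assume "K #> (b q \<otimes> v) = K #> (b p \<otimes> v)"
          then have "K #> (b q \<otimes> v \<otimes> inv v) = K #> (b p \<otimes> v \<otimes> inv v)"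
            using b q(1) vs(1,3) by (metis coset_mult_assoc in_carrier inv_closed m_closed subset)
          then show False
            using inj_onD[OF P(3) _ q(1) vs(3)] q b vs(1,3) by (simp add: m_assoc)
        qed
        then have "?tr v s q \<noteq> e"
          using e b q(1) vs by (simp add: rep_eq_iff)
        then have "?tr v s q \<in> C" using rest q(1) Q by blast
        then show ?thesis using translate q(1) vs by blast
      qed
      have "defect v s \<in> K" using vs S by (intro defect_in) auto
      then have "b p \<otimes> defect v s \<otimes> inv (b p) \<in> M"
        using P(4) M vs(3) others unfolding dependent_conjugates_def by blast
      then show "e \<in> C" using translate vs e by blast
    qed
    moreover have "\<Union>\<R> \<subseteq> R \<times> S" using b by (auto simp: \<R>_def)
    then have "\<Union>\<R> - X \<subseteq> C" using YB_C by (auto simp: X_def)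
    ultimately have "X \<subseteq> C" using closed YB_C by blast
    then have "R \<times> S \<subseteq> C" using YB_C by (auto simp: X_def)
    then have "generate G S \<inter> K \<subseteq> M"
      by (intro generate_Int_subset M S) (auto simp: C_def)
    then show ?thesis by (simp add: M_def)
  qed
  ultimately show ?thesis by blast
qed

end

section \<open>Values of words\<close>
lemma word_value_Nil [simp]: "word_value G [] x = \<one>\<^bsub>G\<^esub>"
  and word_value_Cons [simp]:
    "word_value G ((i, b) # w) x = (if b then x i else inv\<^bsub>G\<^esub> x i) \<otimes>\<^bsub>G\<^esub> word_value G w x"
  by (simp_all add: word_value_def)

lemma word_value_cong:
  "(\<And>i. i \<in> fst ` set w \<Longrightarrow> x i = y i) \<Longrightarrow> word_value G w x = word_value G w y"
proof (induction w)
  case (Cons l w)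
  have "word_value G w x = word_value G w y" using Cons.prems by (intro Cons.IH) auto
  moreover have "x (fst l) = y (fst l)" using Cons.prems[of "fst l"] by simp
  ultimately show ?case by (cases l) simp
qed simp

context group
begin

lemma word_value_closed [simp]:
  "(\<And>i. i \<in> fst ` set w \<Longrightarrow> x i \<in> carrier G) \<Longrightarrow> word_value G w x \<in> carrier G"
proof (induction w)
  case (Cons l w)
  have "word_value G w x \<in> carrier G" using Cons by (intro Cons.IH) auto
  moreover have "x (fst l) \<in> carrier G" using Cons.prems[of "fst l"] by simp
  ultimately show ?case by (cases l) simp
qed simp

lemma word_value_append:
  assumes "\<And>i. i \<in> fst ` set (u @ v) \<Longrightarrow> x i \<in> carrier G"
  shows "word_value G (u @ v) x = word_value G u x \<otimes> word_value G v x"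
  using assms
proof (induction u)
  case Nil
  then show ?case by simp
next
  case (Cons l u)
  have "word_value G (u @ v) x = word_value G u x \<otimes> word_value G v x"
    using Cons.prems by (intro Cons.IH) auto
  moreover have "x (fst l) \<in> carrier G" using Cons.prems[of "fst l"] by simp
  moreover have "word_value G u x \<in> carrier G" "word_value G v x \<in> carrier G"
    using Cons.prems by (auto intro!: word_value_closed)
  ultimately show ?case by (cases l) (simp add: m_assoc)
qed

end

context normal
begin

lemma rcos_absorb_right: "x \<in> carrier G \<Longrightarrow> h \<in> H \<Longrightarrow> H #> (x \<otimes> h) = H #> x"
  using rcos_sum[of x h] rcos_sum[of x \<one>] rcos_const[OF is_group, of h] rcos_const[OF is_group, of \<one>] by simp

lemma rcos_eq_iff:
  assumes "x \<in> carrier G" "y \<in> carrier G"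
  shows "H #> x = H #> y \<longleftrightarrow> inv x \<otimes> y \<in> H"
proof
  assume "H #> x = H #> y"
  then have "H #> \<one> = H #> (inv x \<otimes> y)"
    using assms rcos_sum[of "inv x" x] rcos_sum[of "inv x" y] by simp
  then show "inv x \<otimes> y \<in> H"
    using assms by (metis coset_join1 coset_mult_one inv_closed is_subgroup m_closed subset)
next
  assume "inv x \<otimes> y \<in> H"
  then have "H #> (x \<otimes> (inv x \<otimes> y)) = H #> x" using assms by (intro rcos_absorb_right)
  then show "H #> x = H #> y" using assms by (simp flip: m_assoc)
qed

lemma word_value_rcos:
  assumes "\<And>i. i \<in> fst ` set w \<Longrightarrow> x i \<in> carrier G \<and> y i \<in> carrier G \<and> H #> x i = H #> y i"
  shows "H #> word_value G w x = H #> word_value G w y"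
  using assms
proof (induction w)
  case Nil
  then show ?case by simp
next
  case (Cons l w)
  obtain i b where l: "l = (i, b)" by fastforce
  have i: "x i \<in> carrier G" "y i \<in> carrier G" "H #> x i = H #> y i"
    using Cons.prems[of i] l by auto
  then have inv: "H #> inv (x i) = H #> inv (y i)" by (simp flip: rcos_inv)
  have "H #> word_value G w x = H #> word_value G w y"
    using Cons.prems by (intro Cons.IH) auto
  moreover have "word_value G w x \<in> carrier G" "word_value G w y \<in> carrier G"
    using Cons.prems by (auto intro!: word_value_closed)
  ultimately show ?case using i inv l by (simp flip: rcos_sum)
qed

end

section \<open>Coset identities of minimal length\<close>
lemma coset_identity_subcoset:
  assumes "group G" "coset_identity G T k w K g" "open_normal L G T" "L \<subseteq> K"
    and g': "\<And>i. i < k \<Longrightarrow> g' i \<in> carrier G \<and> K #>\<^bsub>G\<^esub> g i = K #>\<^bsub>G\<^esub> g' i"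
  shows "coset_identity G T k w L g'"
proof -
  interpret group G by fact
  interpret K: normal K G using assms(2) by (simp add: coset_identity_def open_normal_def)
  have g: "g i \<in> carrier G" if "i < k" for i
    using assms(2) that by (simp add: coset_identity_def)
  have letters: "i < k" if "i \<in> fst ` set w" for i
    using assms(2) that by (auto simp: coset_identity_def reduced_word_def)
  have "word_value G w (\<lambda>i. g' i \<otimes>\<^bsub>G\<^esub> h i) = \<one>\<^bsub>G\<^esub>" if h: "\<forall>i<k. h i \<in> L" for h
  proof -
    let ?h = "\<lambda>i. inv\<^bsub>G\<^esub> g i \<otimes>\<^bsub>G\<^esub> g' i \<otimes>\<^bsub>G\<^esub> h i"
    have "?h i \<in> K" if "i < k" for i
    proof -
      have "inv\<^bsub>G\<^esub> g i \<otimes>\<^bsub>G\<^esub> g' i \<in> K" using K.rcos_eq_iff g g' that by blast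
      moreover have "h i \<in> K" using h that assms(4) by blast
      ultimately show ?thesis by simp
    qed
    then have "word_value G w (\<lambda>i. g i \<otimes>\<^bsub>G\<^esub> ?h i) = \<one>\<^bsub>G\<^esub>"
      using assms(2) by (simp add: coset_identity_def)
    moreover have "g i \<otimes>\<^bsub>G\<^esub> ?h i = g' i \<otimes>\<^bsub>G\<^esub> h i" if "i < k" for i
    proof -
      have "h i \<in> carrier G" using that h assms(4) K.subset by blast
      then show ?thesis using g[OF that] g'[OF that] by (simp flip: m_assoc)
    qed
    moreover from this have "word_value G w (\<lambda>i. g i \<otimes>\<^bsub>G\<^esub> ?h i) = word_value G w (\<lambda>i. g' i \<otimes>\<^bsub>G\<^esub> h i)"
      using letters by (auto intro: word_value_cong)
    ultimately show ?thesis by simp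
  qed
  then show ?thesis
    using assms(2,3) g' by (simp add: coset_identity_def)
qed

text \<open>Finitely many words, none of which is a coset identity, can be treated one after the other: moving the
point within its cosets modulo the current \<open>L\<close> makes the value of the next word nontrivial, and a smaller
open normal subgroup then avoids it. The values of the earlier words change only within their
cosets modulo \<open>L\<close>, so they stay outside \<open>L\<close>.\<close>
lemma generic_coset_point:
  assumes P: "profinite_group G T" and "finite U" and "open_normal K G T"
    and g: "\<And>i. i < k \<Longrightarrow> g i \<in> carrier G"
    and letters: "\<And>u i. u \<in> U \<Longrightarrow> i \<in> fst ` set u \<Longrightarrow> i < k"
    and no_identity: "\<And>u L x. \<lbrakk>u \<in> U; open_normal L G T; \<And>i. i < k \<Longrightarrow> x i \<in> carrier G\<rbrakk> \<Longrightarrow>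
      \<exists>h. (\<forall>i<k. h i \<in> L) \<and> word_value G u (\<lambda>i. x i \<otimes>\<^bsub>G\<^esub> h i) \<noteq> \<one>\<^bsub>G\<^esub>"
  shows "\<exists>L x. open_normal L G T \<and> L \<subseteq> K \<and> (\<forall>i<k. x i \<in> carrier G \<and> K #>\<^bsub>G\<^esub> g i = K #>\<^bsub>G\<^esub> x i) \<and>
    (\<forall>u \<in> U. word_value G u x \<notin> L)"
  using assms(2) letters no_identity
proof (induction U rule: finite_induct)
  case empty
  then show ?case using assms(3) g by blast
next
  case (insert u U)
  interpret group G by (rule profinite_groupD[OF P])
  interpret K: normal K G using assms(3) by (simp add: open_normal_def)
  have "\<exists>L x. open_normal L G T \<and> L \<subseteq> K \<and> (\<forall>i<k. x i \<in> carrier G \<and> K #>\<^bsub>G\<^esub> g i = K #>\<^bsub>G\<^esub> x i) \<and>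
    (\<forall>u \<in> U. word_value G u x \<notin> L)"
  proof (rule insert.IH)
    show "i < k" if "u \<in> U" "i \<in> fst ` set u" for u i
      using insert.prems(1) that by blast
    show "\<exists>h. (\<forall>i<k. h i \<in> L) \<and> word_value G u (\<lambda>i. x i \<otimes>\<^bsub>G\<^esub> h i) \<noteq> \<one>\<^bsub>G\<^esub>"
      if "u \<in> U" "open_normal L G T" "\<And>i. i < k \<Longrightarrow> x i \<in> carrier G" for u L x
      by (rule insert.prems(2)) (use that in auto)
  qed
  then obtain L x where L: "open_normal L G T" "L \<subseteq> K"
    and x: "\<And>i. i < k \<Longrightarrow> x i \<in> carrier G" "\<And>i. i < k \<Longrightarrow> K #>\<^bsub>G\<^esub> g i = K #>\<^bsub>G\<^esub> x i"
    and avoid: "\<And>v. v \<in> U \<Longrightarrow> word_value G v x \<notin> L"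
    by blast
  interpret L: normal L G using L(1) by (simp add: open_normal_def)
  obtain h where h: "\<And>i. i < k \<Longrightarrow> h i \<in> L" "word_value G u (\<lambda>i. x i \<otimes>\<^bsub>G\<^esub> h i) \<noteq> \<one>\<^bsub>G\<^esub>"
    using insert.prems(2)[of u L x] L(1) x(1) by auto
  define y where "y = (\<lambda>i. x i \<otimes>\<^bsub>G\<^esub> h i)"
  have y: "y i \<in> carrier G" "L #>\<^bsub>G\<^esub> y i = L #>\<^bsub>G\<^esub> x i" "K #>\<^bsub>G\<^esub> y i = K #>\<^bsub>G\<^esub> x i" if "i < k" for i
    using that h(1)[OF that] x(1)[OF that] L(2) by (auto simp: y_def L.rcos_absorb_right K.rcos_absorb_right)
  have "word_value G u y \<in> carrier G"
    using y(1) insert.prems(1)[of u] by (auto intro!: word_value_closed)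
  then obtain N where N: "open_normal N G T" "word_value G u y \<notin> N"
    using open_normal_subgroup_avoiding[OF P] h(2) unfolding y_def by metis
  have "word_value G v y \<notin> L" if v: "v \<in> U" for v
  proof -
    have c: "word_value G v x \<in> carrier G" "word_value G v y \<in> carrier G"
      using y(1) x(1) insert.prems(1)[of v] v by (auto intro!: word_value_closed)
    have "L #>\<^bsub>G\<^esub> word_value G v x = L #>\<^bsub>G\<^esub> word_value G v y"
      using y x insert.prems(1)[of v] v by (intro L.word_value_rcos) auto
    then show ?thesis
      using avoid[OF v] coset_join1[OF _ c(1) L.is_subgroup] coset_join2[OF c(2) L.is_subgroup] by auto
  qed
  moreover have "open_normal (L \<inter> N) G T"
    by (rule open_normal_Int[OF is_group L(1) N(1)])
  ultimately show ?case
    using N(2) L(2) y x(2) by (intro exI[of _ "L \<inter> N"] exI[of _ y]) auto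
qed

lemma reduced_word_subword:
  "reduced_word k (u @ v @ w) \<Longrightarrow> reduced_word k v"
  by (auto simp: reduced_word_def successively_append_iff)

lemma reduced_word_no_cancel:
  assumes "reduced_word k w" "Suc p < length w" "fst (w ! p) = fst (w ! Suc p)"
  shows "snd (w ! p) = snd (w ! Suc p)"
proof -
  obtain i b j c where "w ! p = (i, b)" "w ! Suc p = (j, c)" by fastforce
  then show ?thesis
    using assms by (auto simp: reduced_word_def successively_conv_nth)
qed

text \<open>Conjugation by the value of \<open>x\<^sub>i\<close> turns a word of the form \<open>x\<^sub>i\<^sup>-\<^sup>1 u x\<^sub>i\<close> into \<open>u\<close>.\<close>
lemma coset_identity_cyclic_reduction:
  assumes "group G" and id: "coset_identity G T k ((i, False) # u @ [(i, True)]) K g"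
  shows "coset_identity G T k u K g"
proof -
  interpret group G by fact
  interpret K: normal K G using id by (simp add: coset_identity_def open_normal_def)
  let ?w = "(i, False) # u @ [(i, True)]"
  have red: "reduced_word k ?w" using id by (simp add: coset_identity_def)
  have "u \<noteq> []" using red by (auto simp: reduced_word_def)
  moreover have "reduced_word k u"
    using reduced_word_subword[of k "[(i, False)]" u "[(i, True)]"] red by simp
  moreover have "word_value G u (\<lambda>i. g i \<otimes>\<^bsub>G\<^esub> h i) = \<one>\<^bsub>G\<^esub>" if h: "\<forall>i<k. h i \<in> K" for h
  proof -
    define x where "x = (\<lambda>i. g i \<otimes>\<^bsub>G\<^esub> h i)"
    have x: "x j \<in> carrier G" if "j \<in> fst ` set ?w" for j
    proof -
      have "j < k" using red that by (auto simp: reduced_word_def)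
      then show ?thesis using id h by (simp add: coset_identity_def x_def)
    qed
    have i: "x i \<in> carrier G" by (rule x) simp
    have u: "word_value G u x \<in> carrier G" by (rule word_value_closed, rule x) auto
    have "word_value G (u @ [(i, True)]) x = word_value G u x \<otimes>\<^bsub>G\<^esub> word_value G [(i, True)] x"
      by (rule word_value_append, rule x) auto
    moreover have "word_value G ?w x = \<one>\<^bsub>G\<^esub>"
      using id h unfolding coset_identity_def x_def by blast
    ultimately have "inv\<^bsub>G\<^esub> x i \<otimes>\<^bsub>G\<^esub> (word_value G u x \<otimes>\<^bsub>G\<^esub> x i) = \<one>\<^bsub>G\<^esub>"
      using i by simp
    then have "word_value G u x \<otimes>\<^bsub>G\<^esub> x i = x i"
      using inv_solve_left'[of "\<one>\<^bsub>G\<^esub>" "x i" "word_value G u x \<otimes>\<^bsub>G\<^esub> x i"] i u by simp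
    then show "word_value G u (\<lambda>i. g i \<otimes>\<^bsub>G\<^esub> h i) = \<one>\<^bsub>G\<^esub>"
      using i u r_cancel_one'[of "x i" "word_value G u x"] by (auto simp: x_def[symmetric])
  qed
  ultimately show ?thesis using id by (simp add: coset_identity_def)
qed

text \<open>For a coset identity of minimal length, proper subwords are reduced words that are shorter than every
coset identity, so a generic point in the sense of \<open>generic_coset_point\<close> exists for all of them at once. The
excluded combination of first and last letter would allow a cyclic reduction, giving a shorter
identity.\<close>
lemma minimal_coset_identity:
  assumes P: "profinite_group G T" and "satisfies_coset_identity_of_length G T m"
  obtains k w K g where "coset_identity G T k w K g" "length w \<le> m"
    and "\<And>i. \<not> (hd w = (i, False) \<and> last w = (i, True))"
    and "\<And>a c. \<lbrakk>a < c; c \<le> length w; c - a < length w\<rbrakk> \<Longrightarrow> word_value G (drop a (take c w)) g \<notin> K"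
proof -
  interpret group G by (rule profinite_groupD[OF P])
  define l where "l = (LEAST l. satisfies_coset_identity_of_length G T l)"
  have "satisfies_coset_identity_of_length G T l" and "l \<le> m"
    unfolding l_def using assms(2) by (rule LeastI, rule Least_le)
  have shortest: False if "coset_identity G T k' u L x" "length u < l" for k' u L x
    using not_less_Least[OF that(2)[unfolded l_def]] that(1)
    by (auto simp: satisfies_coset_identity_of_length_def)
  obtain k w K g where id: "coset_identity G T k w K g" and len: "length w = l"
    using \<open>satisfies_coset_identity_of_length G T l\<close> by (auto simp: satisfies_coset_identity_of_length_def)
  then have red: "reduced_word k w" and "w \<noteq> []" and K: "open_normal K G T" and g: "\<And>i. i < k \<Longrightarrow> g i \<in> carrier G"
    by (auto simp: coset_identity_def)
  define U where "U = (\<lambda>(a, c). drop a (take c w)) ` {(a, c). a < c \<and> c \<le> length w \<and> c - a < length w}"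
  have "{(a, c). a < c \<and> c \<le> length w \<and> c - a < length w} \<subseteq> {..length w} \<times> {..length w}" by auto
  then have "finite U" unfolding U_def by (intro finite_imageI) (rule finite_subset, auto)
  have U: "reduced_word k u" "u \<noteq> []" "length u < l" if "u \<in> U" for u
  proof -
    obtain a c where ac: "u = drop a (take c w)" "a < c" "c \<le> length w" "c - a < length w"
      using \<open>u \<in> U\<close> by (auto simp: U_def)
    have "w = take a w @ u @ drop c w"
      using ac by (metis append_assoc append_take_drop_id less_imp_le min.absorb1 take_take)
    then show "reduced_word k u" using red reduced_word_subword by metis
    show "u \<noteq> []" "length u < l" using ac len by auto
  qed
  have "\<exists>L x. open_normal L G T \<and> L \<subseteq> K \<and> (\<forall>i<k. x i \<in> carrier G \<and> K #>\<^bsub>G\<^esub> g i = K #>\<^bsub>G\<^esub> x i) \<and>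
    (\<forall>u \<in> U. word_value G u x \<notin> L)"
  proof (rule generic_coset_point[OF P \<open>finite U\<close> K g])
    show "i < k" if "u \<in> U" "i \<in> fst ` set u" for u i
      using U(1)[OF that(1)] that(2) by (auto simp: reduced_word_def)
    show "\<exists>h. (\<forall>i<k. h i \<in> L) \<and> word_value G u (\<lambda>i. x i \<otimes>\<^bsub>G\<^esub> h i) \<noteq> \<one>\<^bsub>G\<^esub>"
      if "u \<in> U" "open_normal L G T" "\<And>i. i < k \<Longrightarrow> x i \<in> carrier G" for u L x
    proof (rule ccontr)
      assume "\<not> ?thesis"
      then have "coset_identity G T k u L x"
        using U that by (auto simp: coset_identity_def)
      then show False using shortest U that(1) by blast
    qed
  qed
  then obtain L x where L: "open_normal L G T" "L \<subseteq> K"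
    and x: "\<And>i. i < k \<Longrightarrow> x i \<in> carrier G \<and> K #>\<^bsub>G\<^esub> g i = K #>\<^bsub>G\<^esub> x i"
    and avoid: "\<And>u. u \<in> U \<Longrightarrow> word_value G u x \<notin> L"
    by blast
  show thesis
  proof
    show id': "coset_identity G T k w L x"
      by (rule coset_identity_subcoset[OF is_group id L x])
    show "length w \<le> m" using len \<open>l \<le> m\<close> by simp
    show "\<not> (hd w = (i, False) \<and> last w = (i, True))" for i
    proof
      assume ends: "hd w = (i, False) \<and> last w = (i, True)"
      have "w = (i, False) # tl w" using ends \<open>w \<noteq> []\<close> by (metis list.collapse)
      moreover from this have "tl w \<noteq> []" using ends by (metis last.simps prod.inject)
      moreover from this have "tl w = butlast (tl w) @ [(i, True)]"
        using ends by (metis append_butlast_last_id last_tl)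
      ultimately have w: "w = (i, False) # butlast (tl w) @ [(i, True)]" by simp
      then have "coset_identity G T k (butlast (tl w)) L x"
        using coset_identity_cyclic_reduction[OF is_group] id' by metis
      moreover have "length (butlast (tl w)) < l"
        using len \<open>w \<noteq> []\<close> \<open>tl w \<noteq> []\<close> by (cases w) auto
      ultimately show False by (rule shortest)
    qed
    show "word_value G (drop a (take c w)) x \<notin> L" if "a < c" "c \<le> length w" "c - a < length w" for a c
      using avoid that by (auto simp: U_def)
  qed
qed

text \<open>Let \<open>P\<close> be the set of occurrences of the first letter's variable \<open>x\<^sub>i\<close> in a minimal coset identity \<open>w\<close>.
Replacing \<open>g i\<close> by \<open>g i \<otimes> h\<close> inserts \<open>h\<close> after each occurrence of \<open>x\<^sub>i\<close> and \<open>inv h\<close> before each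
occurrence of its inverse. Pulling the insertions to the front conjugates them by the values \<open>b p\<close> of
the prefixes preceding them. For two occurrences the quotient of these prefix values is the value of the
subword in between. It is nonempty because \<open>w\<close> is reduced, and it is not all of \<open>w\<close> because \<open>w\<close>
does not start with the inverse of \<open>x\<^sub>i\<close> and end with \<open>x\<^sub>i\<close>; so its value is not in \<open>K\<close>.\<close>
lemma coset_identity_dependent_conjugates:
  assumes P: "profinite_group G T" and "satisfies_coset_identity_of_length G T m"
  obtains K P b where "open_normal K G T" "finite (P :: nat set)" "P \<noteq> {}" "card P \<le> m"
    and "b ` P \<subseteq> carrier G" "inj_on (\<lambda>p. K #>\<^bsub>G\<^esub> b p) P" "dependent_conjugates G K P b"
proof -
  interpret group G by (rule profinite_groupD[OF P])
  obtain k w K g where id: "coset_identity G T k w K g" and len: "length w \<le> m"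
    and cyc: "\<And>i. \<not> (hd w = (i, False) \<and> last w = (i, True))"
    and avoid: "\<And>a c. \<lbrakk>a < c; c \<le> length w; c - a < length w\<rbrakk> \<Longrightarrow> word_value G (drop a (take c w)) g \<notin> K"
    using minimal_coset_identity[OF assms] by blast
  have red: "reduced_word k w" and "w \<noteq> []" and K: "open_normal K G T" and g: "\<And>i. i < k \<Longrightarrow> g i \<in> carrier G"
    using id by (auto simp: coset_identity_def)
  interpret K: normal K G using K by (simp add: open_normal_def)
  have letters: "i < k" if "i \<in> fst ` set w" for i
    using red that by (auto simp: reduced_word_def)
  have letters': "g i \<in> carrier G" if "i \<in> fst ` set (take n w)" for i n
    using that letters g by (meson image_mono set_take_subset subsetD)
  define i where "i = fst (hd w)"
  define P where "P = {p. p < length w \<and> fst (w ! p) = i}"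
  \<comment> \<open>The prefix that precedes the insertion includes a positive letter but not a negative one.\<close>
  define pos where "pos p = (if snd (w ! p) then Suc p else p)" for p
  define pre where "pre n = word_value G (take n w) g" for n
  define b where "b p = pre (pos p)" for p
  have pre: "pre n \<in> carrier G" for n
    unfolding pre_def using letters' by (intro word_value_closed)
  have distinct_less: False if pq: "p \<in> P" "q \<in> P" "p < q" "K #>\<^bsub>G\<^esub> b p = K #>\<^bsub>G\<^esub> b q" for p q
  proof -
    have "pos p \<noteq> pos q"
    proof
      assume "pos p = pos q"
      then have "q = Suc p" "snd (w ! p)" "\<not> snd (w ! q)"
        using pq(3) by (auto simp: pos_def split: if_splits)
      then show False
        using reduced_word_no_cancel[OF red, of p] pq by (auto simp: P_def)
    qed
    then have less: "pos p < pos q" using pq(3) by (auto simp: pos_def split: if_splits)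
    have le: "pos q \<le> length w" using pq(2) by (auto simp: pos_def P_def)
    have short: "pos q - pos p < length w"
    proof (rule ccontr)
      assume "\<not> pos q - pos p < length w"
      then have "pos p = 0" "pos q = length w" using le less by auto
      then have "p = 0" "\<not> snd (w ! p)" "Suc q = length w" "snd (w ! q)"
        using pq(2) by (auto simp: pos_def P_def split: if_splits)
      moreover from this have "last w = w ! q" "hd w = w ! p"
        using \<open>w \<noteq> []\<close> by (auto simp: last_conv_nth hd_conv_nth simp flip: \<open>Suc q = length w\<close>)
      ultimately show False
        using cyc[of i] pq(1,2) by (auto simp: P_def prod_eq_iff)
    qed
    let ?u = "drop (pos p) (take (pos q) w)"
    have split: "take (pos q) w = take (pos p) w @ ?u"
      using less by (metis append_take_drop_id less_imp_le min.absorb1 take_take)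
    have u: "word_value G ?u g \<in> carrier G"
    proof (intro word_value_closed)
      fix i assume "i \<in> fst ` set ?u"
      then show "g i \<in> carrier G" using letters' by (meson image_mono set_drop_subset subsetD)
    qed
    have "b q = b p \<otimes>\<^bsub>G\<^esub> word_value G ?u g"
      unfolding b_def pre_def using letters'[where n = "pos q"] split
      by (metis word_value_append)
    then have "inv\<^bsub>G\<^esub> b p \<otimes>\<^bsub>G\<^esub> b q = word_value G ?u g"
      using u pre by (simp add: b_def flip: m_assoc)
    then have "word_value G ?u g \<in> K"
      using pq(4) K.rcos_eq_iff pre by (simp add: b_def)
    then show False using avoid[OF less le short] by blast
  qed
  have relation: "b p \<otimes>\<^bsub>G\<^esub> h \<otimes>\<^bsub>G\<^esub> inv\<^bsub>G\<^esub> (b p) \<in> M"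
    if M: "subgroup M G" and h: "h \<in> K" and p: "p \<in> P"
      and others: "\<And>q. q \<in> P \<Longrightarrow> q \<noteq> p \<Longrightarrow> b q \<otimes>\<^bsub>G\<^esub> h \<otimes>\<^bsub>G\<^esub> inv\<^bsub>G\<^esub> (b q) \<in> M" for M h p
  proof -
    interpret M: subgroup M G by fact
    have hc: "h \<in> carrier G" using h by simp
    define x where "x j = (if j = i then g j \<otimes>\<^bsub>G\<^esub> h else g j)" for j
    define new where "new n = word_value G (take n w) x" for n
    have x: "x j \<in> carrier G" if "j \<in> fst ` set (take n w)" for j n
      using letters'[OF that] hc by (auto simp: x_def)
    have new: "new n \<in> carrier G" for n
      unfolding new_def using x by (intro word_value_closed)
    have "word_value G w (\<lambda>j. g j \<otimes>\<^bsub>G\<^esub> (if j = i then h else \<one>\<^bsub>G\<^esub>)) = \<one>\<^bsub>G\<^esub>"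
      "word_value G w (\<lambda>j. g j \<otimes>\<^bsub>G\<^esub> \<one>\<^bsub>G\<^esub>) = \<one>\<^bsub>G\<^esub>"
      using id h K.one_closed by (auto simp: coset_identity_def)
    moreover have "word_value G w (\<lambda>j. g j \<otimes>\<^bsub>G\<^esub> (if j = i then h else \<one>\<^bsub>G\<^esub>)) = word_value G w x"
      "word_value G w (\<lambda>j. g j \<otimes>\<^bsub>G\<^esub> \<one>\<^bsub>G\<^esub>) = word_value G w g"
      by (rule word_value_cong, simp add: x_def letters g)+
    ultimately have ends: "new (length w) = \<one>\<^bsub>G\<^esub>" "pre (length w) = \<one>\<^bsub>G\<^esub>" "new 0 = \<one>\<^bsub>G\<^esub>" "pre 0 = \<one>\<^bsub>G\<^esub>"
      by (simp_all add: new_def pre_def)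
    \<comment> \<open>The ratio \<open>f\<close> of the new and old values of a prefix is trivial at both ends of \<open>w\<close>. A successive
        quotient \<open>c\<close> is trivial or an inserted conjugate up to inversion, so all but one of them in \<open>M\<close> force the last into \<open>M\<close>.\<close>
    define f where "f n = new n \<otimes>\<^bsub>G\<^esub> inv\<^bsub>G\<^esub> pre n" for n
    define c where "c n = inv\<^bsub>G\<^esub> f n \<otimes>\<^bsub>G\<^esub> f (Suc n)" for n
    have f: "f n \<in> carrier G" for n using new pre by (simp add: f_def)
    have f_Suc: "f (Suc n) = f n \<otimes>\<^bsub>G\<^esub> c n" for n
      using f by (simp add: c_def flip: m_assoc)
    have cancel: "inv\<^bsub>G\<^esub> y \<otimes>\<^bsub>G\<^esub> (y \<otimes>\<^bsub>G\<^esub> z) = z" "y \<otimes>\<^bsub>G\<^esub> (inv\<^bsub>G\<^esub> y \<otimes>\<^bsub>G\<^esub> z) = z"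
      if "y \<in> carrier G" "z \<in> carrier G" for y z
      using that by (simp_all flip: m_assoc)
    have c: "c n = (if n \<in> P then if snd (w ! n) then b n \<otimes>\<^bsub>G\<^esub> h \<otimes>\<^bsub>G\<^esub> inv\<^bsub>G\<^esub> b n
        else inv\<^bsub>G\<^esub> (b n \<otimes>\<^bsub>G\<^esub> h \<otimes>\<^bsub>G\<^esub> inv\<^bsub>G\<^esub> b n) else \<one>\<^bsub>G\<^esub>)" if n: "n < length w" for n
    proof -
      obtain j e where je: "w ! n = (j, e)" by fastforce
      have take: "take (Suc n) w = take n w @ [(j, e)]"
        using n je by (simp add: take_Suc_conv_app_nth)
      have j: "g j \<in> carrier G" "x j \<in> carrier G"
        using letters'[of j "Suc n"] x[of j "Suc n"] take by auto
      let ?lx = "if e then x j else inv\<^bsub>G\<^esub> x j" and ?lg = "if e then g j else inv\<^bsub>G\<^esub> g j"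
      have lc: "?lx \<in> carrier G" "?lg \<in> carrier G" using j by auto
      have "word_value G (take n w @ [(j, e)]) x = new n \<otimes>\<^bsub>G\<^esub> word_value G [(j, e)] x"
        unfolding new_def by (rule word_value_append, rule x[where n = "Suc n"]) (simp only: take)
      then have new_Suc: "new (Suc n) = new n \<otimes>\<^bsub>G\<^esub> ?lx"
        unfolding new_def take using lc(1) by simp
      have "word_value G (take n w @ [(j, e)]) g = pre n \<otimes>\<^bsub>G\<^esub> word_value G [(j, e)] g"
        unfolding pre_def by (rule word_value_append, rule letters'[where n = "Suc n"]) (simp only: take)
      then have pre_Suc: "pre (Suc n) = pre n \<otimes>\<^bsub>G\<^esub> ?lg"
        unfolding pre_def take using lc(2) by simp
      have c_eq: "c n = pre n \<otimes>\<^bsub>G\<^esub> (?lx \<otimes>\<^bsub>G\<^esub> inv\<^bsub>G\<^esub> ?lg) \<otimes>\<^bsub>G\<^esub> inv\<^bsub>G\<^esub> pre n"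
        unfolding c_def f_def new_Suc pre_Suc using new[of n] pre[of n] lc
        by (simp only: inv_mult_group inv_inv inv_closed m_closed m_assoc cancel)
      consider "j \<noteq> i" | "j = i" "e" | "j = i" "\<not> e" by blast
      then show ?thesis
      proof cases
        case 1
        then have "?lx = ?lg" by (simp add: x_def)
        then have "c n = \<one>\<^bsub>G\<^esub>" unfolding c_eq using lc pre[of n] by (simp only: r_inv r_one)
        then show ?thesis using 1 je by (simp add: P_def)
      next
        case 2
        then have "b n = pre n \<otimes>\<^bsub>G\<^esub> g i" using je pre_Suc by (simp add: b_def pos_def)
        then have "b n \<otimes>\<^bsub>G\<^esub> h \<otimes>\<^bsub>G\<^esub> inv\<^bsub>G\<^esub> b n = c n"
          using 2 j pre[of n] hc by (simp add: c_eq x_def inv_mult_group m_assoc)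
        then show ?thesis using 2 je n by (simp add: P_def)
      next
        case 3
        then have "b n = pre n" using je by (simp add: b_def pos_def)
        then have "inv\<^bsub>G\<^esub> (b n \<otimes>\<^bsub>G\<^esub> h \<otimes>\<^bsub>G\<^esub> inv\<^bsub>G\<^esub> b n) = c n"
          using 3 j pre[of n] hc by (simp add: c_eq x_def inv_mult_group m_assoc)
        then show ?thesis using 3 je n by (simp add: P_def)
      qed
    qed
    have c_other: "c n \<in> M" if "n < length w" "n \<noteq> p" for n
      using c[OF that(1)] others[of n] that(2) by auto
    have before: "f n \<in> M" if "n \<le> p" for n
      using that
    proof (induction n)
      case 0
      then show ?case using ends by (simp add: f_def)
    next
      case (Suc n)
      then show ?case using c_other[of n] p by (simp add: f_Suc P_def)
    qed
    have after: "f n \<in> M" if "n \<le> length w" "p < n" for n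
      using that
    proof (induction rule: inc_induct)
      case base
      then show ?case using ends by (simp add: f_def)
    next
      case (step n)
      have "c n \<in> carrier G" using f by (simp add: c_def)
      then have "f n = f (Suc n) \<otimes>\<^bsub>G\<^esub> inv\<^bsub>G\<^esub> c n"
        using f by (simp add: f_Suc m_assoc)
      moreover have "c n \<in> M" "f (Suc n) \<in> M"
        using step c_other[of n] by auto
      ultimately show ?case by simp
    qed
    have p': "p < length w" using p by (simp add: P_def)
    have "c p \<in> M"
      unfolding c_def using before[of p] after[of "Suc p"] p' by simp
    moreover have "inv\<^bsub>G\<^esub> (inv\<^bsub>G\<^esub> (b p \<otimes>\<^bsub>G\<^esub> h \<otimes>\<^bsub>G\<^esub> inv\<^bsub>G\<^esub> b p)) = b p \<otimes>\<^bsub>G\<^esub> h \<otimes>\<^bsub>G\<^esub> inv\<^bsub>G\<^esub> b p"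
      using pre hc by (simp add: b_def)
    ultimately show ?thesis
      using c[OF p'] p by (metis M.m_inv_closed)
  qed
  show thesis
  proof
    show "open_normal K G T" by (rule K)
    show "finite P" by (simp add: P_def)
    have "0 \<in> P" using \<open>w \<noteq> []\<close> by (simp add: P_def i_def hd_conv_nth)
    then show "P \<noteq> {}" by blast
    have "card P \<le> card {..<length w}" by (intro card_mono) (auto simp: P_def)
    then show "card P \<le> m" using len by simp
    show "b ` P \<subseteq> carrier G" by (auto simp: b_def pre)
    show "inj_on (\<lambda>p. K #>\<^bsub>G\<^esub> b p) P"
    proof (rule inj_onI)
      fix p q assume "p \<in> P" "q \<in> P" "K #>\<^bsub>G\<^esub> b p = K #>\<^bsub>G\<^esub> b q"
      then show "p = q"
        using distinct_less[of p q] distinct_less[of q p] by (metis linorder_neqE_nat)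
    qed
    show "dependent_conjugates G K P b"
      unfolding dependent_conjugates_def using relation by blast
  qed
qed

section \<open>Numbers of topological generators\<close>
lemma topologically_generates_open_subgroup:
  assumes G: "group G" "topspace T = carrier G" and K: "subgroup K G" "openin T K"
    and dense: "T closure_of D = carrier G"
    and Z: "Z \<subseteq> K" "D \<inter> K \<subseteq> generate G Z"
  shows "topologically_generates (G\<lparr>carrier := K\<rparr>) (subtopology T K) Z"
proof -
  interpret group G by fact
  have top: "topspace (subtopology T K) = K"
    using openin_subset[OF K(2)] by (simp add: Int_absorb1)
  have meets: "generate G Z \<inter> U \<noteq> {}" if U: "openin (subtopology T K) U" "U \<noteq> {}" for U
  proof -
    have "openin T U" "U \<subseteq> K" using U(1) openin_open_subtopology[OF K(2)] by simp_all
    moreover have "D \<inter> U \<noteq> {}"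
      using dense_intersects_open[of T D] dense G(2) U(2) \<open>openin T U\<close> by simp
    ultimately show ?thesis using Z(2) by blast
  qed
  have "subtopology T K closure_of generate G Z = topspace (subtopology T K)"
    unfolding dense_intersects_open using meets by blast
  then show ?thesis
    using Z(1) generate_consistent[OF Z(1) K(1)] unfolding top by (simp add: topologically_generates_def)
qed

lemma min_generators_le:
  assumes "finite Z" "topologically_generates G T Z"
  shows "min_generators G T \<le> enat (card Z)"
  unfolding min_generators_def by (rule INF_lower) (use assms in simp)

lemma min_generators_attained:
  assumes "topologically_finitely_generated G T"
  obtains S where "finite S" "topologically_generates G T S" "min_generators G T = enat (card S)"
proof -
  let ?P = "\<lambda>S. finite S \<and> topologically_generates G T S"
  let ?A = "(\<lambda>S. enat (card S)) ` Collect ?P"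
  obtain S where "?P S"
    using assms unfolding topologically_finitely_generated_def by (elim exE)
  then have mem: "enat (card S) \<in> ?A" by (intro imageI CollectI)
  have nonempty: "?A \<noteq> {}" by (rule notI) (use mem in \<open>simp only: empty_iff\<close>)
  have "(LEAST x. x \<in> ?A) \<in> ?A" by (rule LeastI[of "\<lambda>x. x \<in> ?A", OF mem])
  then have "min_generators G T \<in> ?A"
    unfolding min_generators_def Inf_enat_def if_not_P[OF nonempty] .
  then obtain S' where "?P S'" "min_generators G T = enat (card S')"
    by (elim imageE CollectE)
  then show thesis by (intro that[of S']) simp_all
qed

text \<open>From \<open>r \<le> n\<close> the hypothesis gives \<open>z / n \<le> d + 2 - d / r\<close>. Replacing \<open>r\<close> by \<open>m\<close>, the claim reduces to
\<open>6 * m \<le> d + 1\<close>.\<close>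
lemma generator_count_bound:
  fixes n d r m z :: nat
  assumes count: "r * z + n * d \<le> r * (n * d + n + r)"
    and "0 < r" "r \<le> n" "r \<le> m" "6 * m < d"
  shows "(real z - 1) / real n < (2 * real m - 1) / (2 * real m) * (real d - 1)"
proof -
  have pos: "0 < real r" "0 < real n" "0 < real m" using assms by auto
  define e where "e = real n * real d"
  have "real (r * z + n * d) \<le> real (r * (n * d + n + r))"
    using count by (rule of_nat_mono)
  then have "real r * real z + e \<le> real r * (e + real n + real r)"
    by (simp only: of_nat_add of_nat_mult e_def)
  moreover have "real r * (e + real n + real r - e / real r) = real r * (e + real n + real r) - e"
    using pos(1) by (simp add: right_diff_distrib)
  ultimately have "real r * real z \<le> real r * (e + real n + real r - e / real r)" by linarith
  then have "real z \<le> e + real n + real r - e / real r" using pos(1) by simp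
  moreover have "e / real m \<le> e / real r"
    using assms(2,4) by (intro divide_left_mono) (auto simp: e_def)
  moreover have "real r \<le> real n" using assms(3) by simp
  ultimately have "real z - 1 < e + 2 * real n - e / real m" by linarith
  then have "(real z - 1) / real n < (e + 2 * real n - e / real m) / real n"
    using pos(2) by (rule divide_strict_right_mono)
  also have "\<dots> = real d + 2 - real d / real m"
    using pos(2) by (simp add: e_def add_divide_distrib diff_divide_distrib)
  also have "\<dots> \<le> real d - 1 - (real d - 1) / (2 * real m)"
  proof -
    have "6 * real m \<le> real d + 1" using assms(5) by linarith
    then have "3 \<le> (real d + 1) / (2 * real m)" using pos(3) by (simp add: le_divide_eq)
    also have "\<dots> = real d / real m - (real d - 1) / (2 * real m)"
      using pos(3) by (simp add: field_simps)
    finally show ?thesis by linarith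
  qed
  also have "\<dots> = (2 * real m - 1) / (2 * real m) * (real d - 1)"
    using pos(3) by (simp add: diff_divide_distrib left_diff_distrib)
  finally show ?thesis .
qed

section \<open>Coset identities and the number of generators\<close>
theorem theorem3:
  fixes G :: "('a, 'b) monoid_scheme" and T :: "'a topology" and m :: nat and \<alpha> :: real
  assumes "profinite_group G T"
    and "topologically_finitely_generated G T"
    and "satisfies_coset_identity_of_length G T m"
    and "min_generators G T > enat (6 * m)"
    and "\<alpha> = (2 * real m - 1) / (2 * real m)"
  shows "\<exists>H. open_normal H G T \<and>
           (ereal_of_enat (min_generators_subgroup G T H) - 1) / ereal (real (card (rcosets\<^bsub>G\<^esub> H)))
             < ereal \<alpha> * (ereal_of_enat (min_generators G T) - 1)"
proof -
  note P = profinite_groupD[OF assms(1)]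
  interpret group G by (rule P)
  obtain S where S: "finite S" "topologically_generates G T S" and d: "min_generators G T = enat (card S)"
    using min_generators_attained[OF assms(2)] .
  have S': "S \<subseteq> carrier G" "T closure_of generate G S = carrier G"
    using S(2) by (auto simp: topologically_generates_def)
  obtain K I b where K: "open_normal K G T"
    and I: "finite (I :: nat set)" "I \<noteq> {}" "card I \<le> m"
    and b: "b ` I \<subseteq> carrier G" "inj_on (\<lambda>p. K #>\<^bsub>G\<^esub> b p) I" "dependent_conjugates G K I b"
    using coset_identity_dependent_conjugates[OF assms(1,3)] .
  interpret K: normal K G using K by (simp add: open_normal_def)
  have fin: "finite (rcosets\<^bsub>G\<^esub> K)" by (rule finite_rcosets[OF assms(1) K])
  have meets: "generate G S \<inter> (K #>\<^bsub>G\<^esub> x) \<noteq> {}" if "x \<in> carrier G" for x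
  proof -
    have "openin T (K #>\<^bsub>G\<^esub> x)" by (rule openin_rcoset[OF assms(1) K that])
    moreover have "K #>\<^bsub>G\<^esub> x \<noteq> {}" using rcos_self[OF that K.is_subgroup] by blast
    ultimately show ?thesis
      using dense_intersects_open[of T "generate G S"] S'(2) P(2) by simp
  qed
  obtain V E where V: "normal_transversal K G V" and tree: "schreier_tree G S V E"
    and card_V: "card V = card (rcosets\<^bsub>G\<^esub> K)"
    using K.schreier_tree_exists[OF fin S'(1) meets] .
  have "card (rcosets\<^bsub>G\<^esub> K) \<noteq> 0"
    using fin rcosetsI[OF K.subset one_closed] by (auto simp: card_eq_0_iff)
  then have "finite V" using card_V by (intro card_ge_0_finite) simp
  have "\<exists>Z \<subseteq> K. finite Z \<and> generate G S \<inter> K \<subseteq> generate G Z \<and>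
    card I * card Z + card V * card S \<le> card I * (card V * card S + card V + card I)"
    by (rule normal_transversal.few_generators[OF V \<open>finite V\<close> S(1) I(1) S'(1) tree I(2) b])
  then obtain Z where Z: "Z \<subseteq> K" "finite Z" "generate G S \<inter> K \<subseteq> generate G Z"
    and count: "card I * card Z + card V * card S \<le> card I * (card V * card S + card V + card I)"
    by blast
  have "card I = card ((\<lambda>p. K #>\<^bsub>G\<^esub> b p) ` I)"
    by (rule card_image[OF b(2), symmetric])
  also have "\<dots> \<le> card V"
    unfolding card_V using rcosetsI[OF K.subset] b(1) by (intro card_mono[OF fin]) blast
  finally have "card I \<le> card V" .
  moreover have "0 < card I" using I(1,2) by (simp add: card_gt_0_iff)
  moreover have "6 * m < card S" using assms(4) unfolding d by simp
  ultimately have bound: "(real (card Z) - 1) / real (card V) < \<alpha> * (real (card S) - 1)"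
    unfolding assms(5) using I(3) by (intro generator_count_bound[OF count])
  have "topologically_generates (G\<lparr>carrier := K\<rparr>) (subtopology T K) Z"
    using K unfolding open_normal_def
    by (intro topologically_generates_open_subgroup[OF P(1,2) K.is_subgroup _ S'(2) Z(1,3)]) simp
  then have "min_generators_subgroup G T K \<le> enat (card Z)"
    by (rule min_generators_le[OF Z(2)])
  then obtain z where z: "min_generators_subgroup G T K = enat z" "z \<le> card Z"
    by (cases "min_generators_subgroup G T K") auto
  have "(real z - 1) / real (card V) \<le> (real (card Z) - 1) / real (card V)"
    using z(2) by (intro divide_right_mono) simp_all
  also note bound
  finally have "(real z - 1) / real (card V) < \<alpha> * (real (card S) - 1)" .
  then have "(ereal_of_enat (min_generators_subgroup G T K) - 1) / ereal (real (card (rcosets\<^bsub>G\<^esub> K)))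
      < ereal \<alpha> * (ereal_of_enat (min_generators G T) - 1)"
    unfolding z(1) d card_V[symmetric] using \<open>card (rcosets\<^bsub>G\<^esub> K) \<noteq> 0\<close>
    by (simp only: ereal_of_enat_simps one_ereal_def ereal_minus ereal_divide times_ereal.simps less_ereal.simps
        card_V of_nat_eq_0_iff if_False)
  with K show ?thesis by blast
qed

end
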